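(* Let $N\ge 1$ be an integer, let $\lambda_1,\ldots,\lambda_N$ be distinct real numbers, and let $\delta>0$ be a real number such that $|\lambda_m-\lambda_n|\ge\delta$ whenever $1\le m,n\le N$ and $m\ne n$. Let $d(1),\ldots,d(N)$ be complex numbers. Then for every $T>0$, $$\Biggl|\int_0^T\Bigl|\sum_{n=1}^N d(n)e^{it\lambda_n}\Bigr|^2dt-T\sum_{n=1}^N|d(n)|^2\Biggr|\le\frac{4\pi}{\delta}\sum_{n=1}^N|d(n)|^2 .$$ *)

theory Defs
  imports "HOL-Analysis.Analysis"
begin

end

theory Submission
  imports Defs
begin

text \<open>
  Expanding the square and integrating termwise, the diagonal terms contribute exactly
  \<open>T * (\<Sum>n. \<bar>d n\<bar>\<^sup>2)\<close>. Every off-diagonal term has an explicit antiderivative, and its values at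
  \<open>T\<close> and at \<open>0\<close> have the shape of the bilinear form
  \<open>\<Sum>r. \<Sum>s. cnj (v r) * v s / (lam r - lam s)\<close>, once for the vector
  \<open>v n = d n * exp (\<i> * T * lam n)\<close> and once for \<open>v = d\<close>. Both vectors have the same norm, so the
  error is at most twice the norm of this form. That norm is at most \<open>pi / \<delta>\<close>
  (\<open>hilbert_inequality_separated\<close>, the Montgomery--Vaughan form of Hilbert's inequality), which
  yields \<open>2 * pi / \<delta>\<close> (\<open>mean_value_separated_frequencies\<close>), half the constant of \<open>proposition6\<close>.

  For Hilbert's inequality, the kernel \<open>1 / (lam r - lam s)\<close> is real and skew-symmetric, so after
  multiplication by \<open>\<i>\<close> it is Hermitian, and its form is controlled by its largest eigenvalue
  (\<open>hermitian_top_eigenvector\<close>). For a unit eigenvector \<open>u\<close>, the squared norm of the image of \<open>u\<close>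
  is expanded by partial fractions. The contributions involving the row sums of the kernel cancel
  exactly because \<open>u\<close> is an eigenvector, and what remains contains only the squares of the kernel
  (\<open>skew_eigenvalue_bound\<close>). As the frequencies are \<open>\<delta>\<close>-separated, these squares are summed
  by comparison with \<open>\<Sum>k. 1 / k\<^sup>2 = pi\<^sup>2 / 6\<close> on each side of a given frequency.
\<close>

section \<open>Inverse squares over separated points\<close>

text \<open>
  Dividing by \<open>\<delta>\<close> and rounding down sends the points of \<open>X\<close> to distinct positive integers, since
  two points with the same image would be closer than \<open>\<delta>\<close>.
\<close>

lemma sum_inverse_squares_separated:
  fixes X :: "real set" and \<delta> :: real
  assumes fin: "finite X" and "\<delta> > 0"
    and ge: "\<And>x. x \<in> X \<Longrightarrow> x \<ge> \<delta>"
    and sep: "\<And>x y. x \<in> X \<Longrightarrow> y \<in> X \<Longrightarrow> x \<noteq> y \<Longrightarrow> \<bar>x - y\<bar> \<ge> \<delta>"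
  shows "(\<Sum>x\<in>X. 1 / x\<^sup>2) \<le> pi\<^sup>2 / (6 * \<delta>\<^sup>2)"
proof -
  \<comment> \<open>The shift by one matches the indexing of the Basel series, which starts with \<open>1 / (0 + 1)\<^sup>2\<close>.\<close>
  define k where "k x = nat (\<lfloor>x / \<delta>\<rfloor> - 1)" for x
  have k_real: "real (k x) + 1 = of_int \<lfloor>x / \<delta>\<rfloor>" if "x \<in> X" for x
  proof -
    have "1 \<le> x / \<delta>" using ge[OF that] \<open>\<delta> > 0\<close> by simp
    then have "1 \<le> \<lfloor>x / \<delta>\<rfloor>" by linarith
    then show ?thesis by (simp add: k_def)
  qed
  have inj: "inj_on k X"
  proof (rule inj_onI, rule ccontr)
    fix x y assume xy: "x \<in> X" "y \<in> X" "k x = k y" "x \<noteq> y"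
    have "\<lfloor>x / \<delta>\<rfloor> = \<lfloor>y / \<delta>\<rfloor>"
      using k_real[OF xy(1)] k_real[OF xy(2)] xy(3) by linarith
    then have "\<bar>x / \<delta> - y / \<delta>\<bar> < 1" by linarith
    then have "\<bar>x - y\<bar> < \<delta>"
      using \<open>\<delta> > 0\<close> by (simp add: diff_divide_distrib[symmetric] abs_divide)
    then show False using sep[OF xy(1,2,4)] by simp
  qed
  have "1 / x\<^sup>2 \<le> 1 / \<delta>\<^sup>2 * (1 / (real (k x) + 1)\<^sup>2)" if "x \<in> X" for x
  proof -
    have "real (k x) + 1 \<le> x / \<delta>" unfolding k_real[OF that] by linarith
    then have "\<delta> * (real (k x) + 1) \<le> x" using \<open>\<delta> > 0\<close> by (simp add: field_simps)
    then have "(\<delta> * (real (k x) + 1))\<^sup>2 \<le> x\<^sup>2"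
      using \<open>\<delta> > 0\<close> by (intro power_mono) auto
    then have "1 / x\<^sup>2 \<le> 1 / (\<delta> * (real (k x) + 1))\<^sup>2"
      using \<open>\<delta> > 0\<close> by (intro divide_left_mono) (auto simp: ge[OF that] intro!: mult_pos_pos)
    then show ?thesis by (simp add: power_mult_distrib)
  qed
  then have "(\<Sum>x\<in>X. 1 / x\<^sup>2) \<le> (\<Sum>x\<in>X. 1 / \<delta>\<^sup>2 * (1 / (real (k x) + 1)\<^sup>2))"
    by (rule sum_mono)
  also have "\<dots> = 1 / \<delta>\<^sup>2 * (\<Sum>j\<in>k ` X. 1 / (real j + 1)\<^sup>2)"
    by (simp add: sum.reindex[OF inj] sum_distrib_left)
  also have "\<dots> \<le> 1 / \<delta>\<^sup>2 * (pi\<^sup>2 / 6)"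
  proof (rule mult_left_mono)
    have "(\<Sum>j\<in>k ` X. 1 / (real j + 1)\<^sup>2) \<le> (\<Sum>j. 1 / (real j + 1)\<^sup>2)"
      using fin inverse_squares_sums by (intro sum_le_suminf) (auto simp: sums_iff add_ac)
    then show "(\<Sum>j\<in>k ` X. 1 / (real j + 1)\<^sup>2) \<le> pi\<^sup>2 / 6"
      using inverse_squares_sums by (simp add: sums_iff add_ac)
  qed simp
  finally show ?thesis by (simp add: field_simps)
qed

text \<open>
  The frequencies below \<open>lam s\<close> and those above it each contribute at most \<open>pi\<^sup>2 / (6 * \<delta>\<^sup>2)\<close>. The
  term \<open>r = s\<close> may stay in the sum because division by zero gives zero; this convention makes the
  Hilbert kernel vanish on the diagonal throughout.
\<close>

lemma sum_inverse_squares_differences: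
  fixes lam :: "'a \<Rightarrow> real" and \<delta> :: real
  assumes fin: "finite I" and "\<delta> > 0" and s: "s \<in> I"
    and sep: "\<And>m n. m \<in> I \<Longrightarrow> n \<in> I \<Longrightarrow> m \<noteq> n \<Longrightarrow> \<bar>lam m - lam n\<bar> \<ge> \<delta>"
  shows "(\<Sum>r\<in>I. (1 / (lam s - lam r))\<^sup>2) \<le> pi\<^sup>2 / (3 * \<delta>\<^sup>2)"
proof -
  \<comment> \<open>The sign \<open>e\<close> turns the differences on the chosen side into positive numbers.\<close>
  have one_side: "(\<Sum>r\<in>J. (1 / (lam s - lam r))\<^sup>2) \<le> pi\<^sup>2 / (6 * \<delta>\<^sup>2)"
    if J: "J \<subseteq> I" "\<And>r. r \<in> J \<Longrightarrow> e * (lam s - lam r) > 0" and e: "\<bar>e\<bar> = 1" for J and e :: real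
  proof -
    have fJ: "finite J" using J(1) fin by (rule finite_subset)
    have absd: "\<bar>e * z\<bar> = \<bar>z\<bar>" for z using e by (simp add: abs_mult)
    have e2: "e\<^sup>2 = 1" using e by (metis power2_abs one_power2)
    define g where "g r = e * (lam s - lam r)" for r
    have gdiff: "\<bar>g p - g q\<bar> = \<bar>lam q - lam p\<bar>" for p q
      using absd[of "lam q - lam p"] by (simp add: g_def algebra_simps)
    have gsep: "\<bar>g p - g q\<bar> \<ge> \<delta>" if "p \<in> J" "q \<in> J" "p \<noteq> q" for p q
      unfolding gdiff using that J(1) by (intro sep) auto
    have inj: "inj_on g J"
      using gsep \<open>\<delta> > 0\<close> by (intro inj_onI) (metis abs_0 diff_self not_less)
    have ge: "g r \<ge> \<delta>" if "r \<in> J" for r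
    proof -
      have pos: "g r > 0" using J(2)[OF that] by (simp add: g_def)
      then have "r \<noteq> s" by (auto simp: g_def)
      then have "\<bar>lam s - lam r\<bar> \<ge> \<delta>" using sep s that J(1) by blast
      then show ?thesis using pos absd[of "lam s - lam r"] by (simp add: g_def)
    qed
    have "(\<Sum>r\<in>J. (1 / (lam s - lam r))\<^sup>2) = (\<Sum>x\<in>g ` J. 1 / x\<^sup>2)"
      unfolding sum.reindex[OF inj] o_def
      by (simp add: g_def power_divide power_mult_distrib e2)
    also have "\<dots> \<le> pi\<^sup>2 / (6 * \<delta>\<^sup>2)"
      using fJ \<open>\<delta> > 0\<close> ge gsep by (intro sum_inverse_squares_separated) force+
    finally show ?thesis .
  qed
  define A where "A = {r \<in> I. lam s > lam r}"
  define B where "B = {r \<in> I. lam s < lam r}"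
  have "(\<Sum>r\<in>I. (1 / (lam s - lam r))\<^sup>2) = (\<Sum>r\<in>A \<union> B. (1 / (lam s - lam r))\<^sup>2)"
    by (rule sum.mono_neutral_right) (auto simp: fin A_def B_def)
  also have "\<dots> = (\<Sum>r\<in>A. (1 / (lam s - lam r))\<^sup>2) + (\<Sum>r\<in>B. (1 / (lam s - lam r))\<^sup>2)"
    by (rule sum.union_disjoint) (auto simp: fin A_def B_def)
  also have "\<dots> \<le> pi\<^sup>2 / (6 * \<delta>\<^sup>2) + pi\<^sup>2 / (6 * \<delta>\<^sup>2)"
    by (intro add_mono one_side[of _ 1] one_side[of _ "-1"]) (auto simp: A_def B_def)
  finally show ?thesis by simp
qed

section \<open>The largest eigenvalue of a Hermitian form\<close>

text \<open>
  By compactness the form attains a maximum \<open>\<mu>\<close> on the unit sphere, at some \<open>u\<close>. Then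
  \<open>\<mu> * norm v ^ 2 - Q v\<close> is a nonnegative quadratic form vanishing at \<open>u\<close>, so its first variation
  at \<open>u\<close> vanishes in every direction; the direction \<open>g\<close>, the defect
  \<open>\<mu> * u - a u\<close> itself, shows that \<open>u\<close> is an eigenvector.
\<close>

lemma hermitian_top_eigenvector:
  fixes a :: "'a \<Rightarrow> 'a \<Rightarrow> complex"
  assumes fin: "finite I" and ne: "I \<noteq> {}"
    and herm: "\<And>r s. r \<in> I \<Longrightarrow> s \<in> I \<Longrightarrow> a s r = cnj (a r s)"
  obtains \<mu> :: real and u :: "'a \<Rightarrow> complex" where "(\<Sum>r\<in>I. (cmod (u r))\<^sup>2) = 1"
    and "\<And>r. r \<in> I \<Longrightarrow> (\<Sum>s\<in>I. a r s * u s) = \<mu> * u r"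
    and "\<And>v. Re (\<Sum>r\<in>I. \<Sum>s\<in>I. a r s * cnj (v r) * v s) \<le> \<mu> * (\<Sum>r\<in>I. (cmod (v r))\<^sup>2)"
proof -
  define Q where "Q v = Re (\<Sum>r\<in>I. \<Sum>s\<in>I. a r s * cnj (v r) * v s)" for v
  define nrm where "nrm v = (\<Sum>r\<in>I. (cmod (v r))\<^sup>2)" for v :: "'a \<Rightarrow> complex"
  \<comment> \<open>Coordinates outside \<open>I\<close> are pinned to zero, so that the unit sphere sits inside a product of
    compact sets and is compact in the product topology.\<close>
  define S where "S = (PiE UNIV (\<lambda>i. if i \<in> I then cball 0 1 else {0})) \<inter> {v. nrm v = 1}"
  have "compact (PiE (UNIV :: 'a set) (\<lambda>i. if i \<in> I then cball 0 1 else {0 :: complex}))"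
    unfolding compactin_euclidean_iff[symmetric] euclidean_product_topology[symmetric]
    by (subst compactin_PiE) (simp split: if_split)
  moreover have "closed {v. nrm v = 1}"
    unfolding nrm_def by (intro closed_Collect_eq continuous_intros continuous_on_product_then_coordinatewise continuous_on_id)
  ultimately have "compact S" unfolding S_def by (rule compact_Int_closed)
  moreover have "S \<noteq> {}"
  proof -
    obtain i where "i \<in> I" using ne by blast
    have "nrm (\<lambda>j. if j = i then 1 else 0) = (\<Sum>r\<in>I. if r = i then 1 else 0)"
      unfolding nrm_def by (intro sum.cong) auto
    then have "(\<lambda>j. if j = i then 1 else 0) \<in> S"
      using \<open>i \<in> I\<close> fin by (auto simp: S_def)
    then show ?thesis by blast
  qed
  moreover have "continuous_on S Q"
    unfolding Q_def by (intro continuous_intros continuous_on_product_then_coordinatewise continuous_on_id)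
  ultimately have "\<exists>u\<in>S. \<forall>v\<in>S. Q v \<le> Q u"
    by (rule continuous_attains_sup)
  then obtain u where u: "u \<in> S" and umax: "\<And>v. v \<in> S \<Longrightarrow> Q v \<le> Q u"
    by blast
  define \<mu> where "\<mu> = Q u"
  have nu: "nrm u = 1" using u by (simp add: S_def)
  have nn: "nrm v \<ge> 0" for v unfolding nrm_def by (intro sum_nonneg) auto
  have max: "Q v \<le> \<mu> * nrm v" for v
  proof (cases "nrm v = 0")
    case True
    then have "\<forall>r\<in>I. v r = 0" using fin by (auto simp: nrm_def sum_nonneg_eq_0_iff)
    then have "Q v = 0" by (simp add: Q_def)
    then show ?thesis using True by simp
  next
    case False
    define c where "c = 1 / sqrt (nrm v)"
    have c2: "c\<^sup>2 = 1 / nrm v" using nn[of v] by (simp add: c_def power_divide)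
    define w where "w r = (if r \<in> I then c * v r else 0)" for r
    have "nrm w = (\<Sum>r\<in>I. c\<^sup>2 * (cmod (v r))\<^sup>2)"
      unfolding nrm_def by (intro sum.cong) (auto simp: w_def norm_mult power_mult_distrib)
    then have nw_scale: "nrm w = c\<^sup>2 * nrm v" by (simp only: nrm_def sum_distrib_left)
    then have nw: "nrm w = 1" using False by (simp add: c2)
    have "cmod (w r) \<le> 1" if "r \<in> I" for r
    proof -
      have "(cmod (w r))\<^sup>2 \<le> nrm w" unfolding nrm_def
        using that fin by (intro member_le_sum) auto
      then show ?thesis using nw abs_square_le_1[of "cmod (w r)"] by simp
    qed
    then have "w \<in> S" using nw by (auto simp: S_def w_def)
    then have "Q w \<le> \<mu>" using umax by (simp add: \<mu>_def)
    moreover have "Q w = c\<^sup>2 * Q v"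
    proof -
      have Re_scale: "Re (complex_of_real x * z) = x * Re z" for x z by simp
      have "(\<Sum>r\<in>I. \<Sum>s\<in>I. a r s * cnj (w r) * w s)
          = complex_of_real (c\<^sup>2) * (\<Sum>r\<in>I. \<Sum>s\<in>I. a r s * cnj (v r) * v s)"
        unfolding sum_distrib_left
        by (intro sum.cong) (auto simp: w_def power2_eq_square)
      then show ?thesis unfolding Q_def by (simp only: Re_scale)
    qed
    ultimately show ?thesis using False nn[of v] by (simp add: c2 field_simps)
  qed
  \<comment> \<open>\<open>ip\<close> is the Hermitian sesquilinear form whose quadratic form is \<open>\<mu> * nrm v - Q v\<close>.\<close>
  define L where "L v r = \<mu> * v r - (\<Sum>s\<in>I. a r s * v s)" for v :: "'a \<Rightarrow> complex" and r
  define ip where "ip v w = (\<Sum>r\<in>I. cnj (v r) * L w r)" for v w :: "'a \<Rightarrow> complex"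
  have ip_P: "Re (ip v v) = \<mu> * nrm v - Q v" for v
  proof -
    have "ip v v = \<mu> * (\<Sum>r\<in>I. cnj (v r) * v r) - (\<Sum>r\<in>I. \<Sum>s\<in>I. a r s * cnj (v r) * v s)"
      by (simp add: ip_def L_def algebra_simps sum_subtractf sum_distrib_left)
    moreover have "(\<Sum>r\<in>I. cnj (v r) * v r) = complex_of_real (nrm v)"
      by (simp add: nrm_def complex_norm_square mult.commute del: of_real_power)
    ultimately show ?thesis by (simp add: Q_def)
  qed
  have ip_sym: "ip v w = cnj (ip w v)" for v w
  proof -
    have "(\<Sum>r\<in>I. \<Sum>s\<in>I. a r s * cnj (v r) * w s) = (\<Sum>s\<in>I. \<Sum>r\<in>I. a r s * cnj (v r) * w s)"
      by (rule sum.swap)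
    also have "\<dots> = (\<Sum>s\<in>I. \<Sum>r\<in>I. cnj (a s r) * cnj (v r) * w s)"
      by (intro sum.cong refl) (metis herm)
    finally show ?thesis
      by (simp add: ip_def L_def algebra_simps sum_subtractf sum_distrib_left)
  qed
  define g where "g = L u"
  define G where "G = nrm g"
  have ip_gu: "ip g u = G"
    by (simp add: ip_def G_def nrm_def complex_norm_square mult.commute g_def del: of_real_power)
  have quad: "0 \<le> - 2 * t * G + t\<^sup>2 * Re (ip g g)" for t :: real
  proof -
    define w where "w r = u r - t * g r" for r
    have Lw: "L w r = L u r - t * L g r" for r
      by (simp add: w_def L_def algebra_simps sum_subtractf sum_distrib_left)
    have "ip w w = ip u u - t * ip u g - t * ip g u + t\<^sup>2 * ip g g"
      by (simp add: ip_def Lw, simp add: w_def algebra_simps sum_subtractf sum.distrib sum_distrib_left power2_eq_square)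
    then have "Re (ip w w) = Re (ip u u) - t * Re (ip u g) - t * Re (ip g u) + t\<^sup>2 * Re (ip g g)"
      by (simp flip: of_real_power)
    moreover have "Re (ip u g) = G" "Re (ip g u) = G" using ip_sym[of u g] ip_gu by simp_all
    moreover have "Re (ip u u) = 0" by (simp add: ip_P nu \<mu>_def)
    moreover have "Re (ip w w) \<ge> 0" using max[of w] by (simp add: ip_P)
    ultimately show ?thesis by (simp add: mult_ac)
  qed
  have "G = 0"
  proof (rule ccontr)
    assume "G \<noteq> 0"
    then have "G > 0" using nn[of g] by (simp add: G_def)
    \<comment> \<open>A small step from \<open>u\<close> against the defect: for this \<open>t\<close> the quadratic term is at most
      half the size of the linear one.\<close>
    define p where "p = \<bar>Re (ip g g)\<bar> + 1"
    define t where "t = G / p"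
    have "p > 0" "t > 0" "Re (ip g g) \<le> p" using \<open>G > 0\<close> by (auto simp: p_def t_def)
    have "t\<^sup>2 * Re (ip g g) \<le> t\<^sup>2 * p" using \<open>Re (ip g g) \<le> p\<close> by (intro mult_left_mono) auto
    also have "\<dots> = t * G" using \<open>p > 0\<close> by (simp add: t_def power2_eq_square)
    finally have "0 \<le> - (t * G)" using quad[of t] by simp
    then show False using mult_pos_pos[OF \<open>t > 0\<close> \<open>G > 0\<close>] by simp
  qed
  then have "g r = 0" if "r \<in> I" for r
    using that fin by (auto simp: G_def nrm_def sum_nonneg_eq_0_iff)
  then have "(\<Sum>s\<in>I. a r s * u s) = \<mu> * u r" if "r \<in> I" for r
    using that by (simp add: g_def L_def)
  then show thesis using that[of u \<mu>] nu max unfolding nrm_def Q_def by blast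
qed

section \<open>Hilbert's inequality for separated frequencies\<close>

text \<open>
  Write \<open>c r s = 1 / (lam r - lam s)\<close> and let \<open>A s\<close> be the sum of \<open>c r s\<close> over \<open>r\<close>. By partial
  fractions, \<open>c r s * c r t = c s t * (c r s - c r t)\<close> for distinct indices, so summing over \<open>r\<close>
  expresses the Gram matrix of \<open>c\<close> as \<open>c s t * (A s - A t) + 2 * (c s t)\<^sup>2\<close> plus a diagonal. Paired
  with the eigenvector, the two parts containing \<open>A\<close> both equal
  \<open>- \<i> * \<mu> * (\<Sum>s. A s * \<bar>u s\<bar>\<^sup>2)\<close> and cancel. The squares give at most \<open>2 * B\<close> by
  \<open>2 * \<bar>u s * u t\<bar> \<le> \<bar>u s\<bar>\<^sup>2 + \<bar>u t\<bar>\<^sup>2\<close>, and the diagonal gives at most \<open>B\<close>.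
\<close>

lemma skew_eigenvalue_bound:
  fixes lam :: "'a \<Rightarrow> real" and u :: "'a \<Rightarrow> complex" and \<mu> B :: real
  assumes fin: "finite I" and inj: "inj_on lam I"
    and norm1: "(\<Sum>r\<in>I. (cmod (u r))\<^sup>2) = 1"
    and eig: "\<And>r. r \<in> I \<Longrightarrow> (\<Sum>s\<in>I. complex_of_real (1 / (lam r - lam s)) * u s) = \<i> * \<mu> * u r"
    and B: "\<And>s. s \<in> I \<Longrightarrow> (\<Sum>r\<in>I. (1 / (lam s - lam r))\<^sup>2) \<le> B"
  shows "\<mu>\<^sup>2 \<le> 3 * B"
proof -
  define c where "c r s = 1 / (lam r - lam s)" for r s
  define A where "A s = (\<Sum>r\<in>I. c r s)" for s
  have c_skew: "c s r = - c r s" for r s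
    by (simp add: c_def minus_divide_right)
  have c2_sym: "(c s r)\<^sup>2 = (c r s)\<^sup>2" for r s by (simp add: c_skew[of s r])
  have c_refl: "c r r = 0" for r by (simp add: c_def)
  \<comment> \<open>The corrections account for coinciding indices, where the kernel has the value zero and the
    partial fraction identity breaks down.\<close>
  have pointwise: "c r s * c r t = c s t * (c r s - c r t)
      + (if r = s then (c s t)\<^sup>2 else 0) + (if r = t then (c s t)\<^sup>2 else 0)
      + (if s = t then (c r s)\<^sup>2 else 0)"
    if "r \<in> I" "s \<in> I" "t \<in> I" for r s t
  proof (cases "r = s \<or> r = t \<or> s = t")
    case True
    then show ?thesis
      using c_skew[of t s] by (auto simp: c_refl power2_eq_square)
  next
    case False
    then have "lam r - lam s \<noteq> 0" "lam r - lam t \<noteq> 0" "lam s - lam t \<noteq> 0"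
      using that inj by (auto dest: inj_onD)
    then have "c r s * c r t = c s t * (c r s - c r t)"
      by (simp add: c_def field_simps)
    then show ?thesis using False by simp
  qed
  have summed: "(\<Sum>r\<in>I. c r s * c r t) = c s t * A s - c s t * A t + 2 * (c s t)\<^sup>2
      + (if s = t then (\<Sum>r\<in>I. (c r s)\<^sup>2) else 0)"
    if "s \<in> I" "t \<in> I" for s t
  proof -
    have "(\<Sum>r\<in>I. c r s * c r t) = (\<Sum>r\<in>I. c s t * (c r s - c r t)
      + (if r = s then (c s t)\<^sup>2 else 0) + (if r = t then (c s t)\<^sup>2 else 0)
      + (if s = t then (c r s)\<^sup>2 else 0))"
      using that by (intro sum.cong refl pointwise)
    then show ?thesis
      using that fin by (simp add: sum.distrib A_def algebra_simps sum_subtractf sum_distrib_left)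
  qed
  have eig': "(\<Sum>s\<in>I. c r s * u s) = \<i> * \<mu> * u r" if "r \<in> I" for r
    using eig[OF that] by (simp add: c_def)
  have eig_cnj: "(\<Sum>s\<in>I. c r s * cnj (u s)) = - \<i> * \<mu> * cnj (u r)" if "r \<in> I" for r
  proof -
    have "(\<Sum>s\<in>I. c r s * cnj (u s)) = cnj (\<Sum>s\<in>I. c r s * u s)" by simp
    then show ?thesis by (simp add: eig'[OF that])
  qed
  have term_s: "(\<Sum>s\<in>I. \<Sum>t\<in>I. u s * cnj (u t) * (c s t * A s))
      = - \<i> * \<mu> * (\<Sum>s\<in>I. A s * u s * cnj (u s))"
  proof -
    have "(\<Sum>s\<in>I. \<Sum>t\<in>I. u s * cnj (u t) * (c s t * A s))
        = (\<Sum>s\<in>I. A s * u s * (\<Sum>t\<in>I. c s t * cnj (u t)))"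
      by (simp add: sum_distrib_left mult_ac)
    also have "\<dots> = (\<Sum>s\<in>I. A s * u s * (- \<i> * \<mu> * cnj (u s)))"
      by (intro sum.cong refl) (simp only: eig_cnj)
    finally show ?thesis by (simp add: sum_distrib_left mult_ac sum_negf)
  qed
  have term_t: "(\<Sum>s\<in>I. \<Sum>t\<in>I. u s * cnj (u t) * (c s t * A t))
      = - \<i> * \<mu> * (\<Sum>s\<in>I. A s * u s * cnj (u s))"
  proof -
    have "(\<Sum>s\<in>I. \<Sum>t\<in>I. u s * cnj (u t) * (c s t * A t))
        = (\<Sum>t\<in>I. \<Sum>s\<in>I. u s * cnj (u t) * (c s t * A t))" by (rule sum.swap)
    also have "\<dots> = (\<Sum>t\<in>I. - (A t * cnj (u t) * (\<Sum>s\<in>I. c t s * u s)))"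
    proof (intro sum.cong refl)
      fix t assume "t \<in> I"
      have "(\<Sum>s\<in>I. u s * cnj (u t) * (c s t * A t)) = (\<Sum>s\<in>I. - (A t * cnj (u t) * (c t s * u s)))"
        by (intro sum.cong refl) (simp add: c_skew[of t] mult_ac)
      then show "(\<Sum>s\<in>I. u s * cnj (u t) * (c s t * A t)) = - (A t * cnj (u t) * (\<Sum>s\<in>I. c t s * u s))"
        by (simp add: sum_negf sum_distrib_left)
    qed
    also have "\<dots> = (\<Sum>t\<in>I. - (A t * cnj (u t) * (\<i> * \<mu> * u t)))"
      by (intro sum.cong refl) (simp only: eig')
    finally show ?thesis by (simp add: sum_distrib_left mult_ac sum_negf)
  qed
  have diag: "(\<Sum>s\<in>I. \<Sum>t\<in>I. u s * cnj (u t) * complex_of_real (if s = t then (\<Sum>r\<in>I. (c r s)\<^sup>2) else 0))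
      = (\<Sum>s\<in>I. complex_of_real ((cmod (u s))\<^sup>2 * (\<Sum>r\<in>I. (c r s)\<^sup>2)))"
    using fin by (simp add: if_distrib[of complex_of_real] if_distrib[of "(*) _"] complex_norm_square del: of_real_power cong: if_cong)
  have "complex_of_real (\<mu>\<^sup>2) = (\<Sum>r\<in>I. complex_of_real ((cmod (\<i> * \<mu> * u r))\<^sup>2))"
    using norm1 by (simp add: norm_mult power_mult_distrib flip: of_real_sum of_real_power sum_distrib_left of_real_mult)
  also have "\<dots> = (\<Sum>r\<in>I. (\<Sum>s\<in>I. c r s * u s) * cnj (\<Sum>t\<in>I. c r t * u t))"
    by (intro sum.cong refl) (simp only: eig' complex_norm_square)
  also have "\<dots> = (\<Sum>r\<in>I. \<Sum>s\<in>I. \<Sum>t\<in>I. u s * cnj (u t) * complex_of_real (c r s * c r t))"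
    by (simp add: sum_product mult_ac)
  also have "\<dots> = (\<Sum>s\<in>I. \<Sum>r\<in>I. \<Sum>t\<in>I. u s * cnj (u t) * complex_of_real (c r s * c r t))"
    by (rule sum.swap)
  also have "\<dots> = (\<Sum>s\<in>I. \<Sum>t\<in>I. \<Sum>r\<in>I. u s * cnj (u t) * complex_of_real (c r s * c r t))"
    by (intro sum.cong refl sum.swap)
  also have "\<dots> = (\<Sum>s\<in>I. \<Sum>t\<in>I. u s * cnj (u t) * complex_of_real (\<Sum>r\<in>I. c r s * c r t))"
    by (simp add: sum_distrib_left)
  also have "\<dots> = (\<Sum>s\<in>I. \<Sum>t\<in>I. u s * cnj (u t) * (c s t * A s)
      - u s * cnj (u t) * (c s t * A t)
      + 2 * (u s * cnj (u t) * (c s t)\<^sup>2)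
      + u s * cnj (u t) * complex_of_real (if s = t then (\<Sum>r\<in>I. (c r s)\<^sup>2) else 0))"
    by (intro sum.cong refl) (simp only: summed of_real_add of_real_diff of_real_mult of_real_power of_real_numeral ring_distribs mult_ac)
  also have "\<dots> = 2 * (\<Sum>s\<in>I. \<Sum>t\<in>I. u s * cnj (u t) * (c s t)\<^sup>2)
      + (\<Sum>s\<in>I. complex_of_real ((cmod (u s))\<^sup>2 * (\<Sum>r\<in>I. (c r s)\<^sup>2)))"
    unfolding sum.distrib sum_subtractf term_s term_t diag by (simp add: sum_distrib_left)
  finally have "\<mu>\<^sup>2 = Re (2 * (\<Sum>s\<in>I. \<Sum>t\<in>I. u s * cnj (u t) * (c s t)\<^sup>2)
      + (\<Sum>s\<in>I. complex_of_real ((cmod (u s))\<^sup>2 * (\<Sum>r\<in>I. (c r s)\<^sup>2))))"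
    by (metis Re_complex_of_real)
  then have expansion: "\<mu>\<^sup>2 = 2 * (\<Sum>s\<in>I. \<Sum>t\<in>I. Re (u s * cnj (u t)) * (c s t)\<^sup>2)
      + (\<Sum>s\<in>I. (cmod (u s))\<^sup>2 * (\<Sum>r\<in>I. (c r s)\<^sup>2))"
    by (simp flip: of_real_power of_real_mult)
  define W where "W = (\<Sum>s\<in>I. (cmod (u s))\<^sup>2 * (\<Sum>r\<in>I. (c r s)\<^sup>2))"
  have "(\<Sum>r\<in>I. (c r s)\<^sup>2) \<le> B" if "s \<in> I" for s
    using B[OF that] by (simp add: c2_sym[of s] c_def[of s, symmetric])
  then have "W \<le> (\<Sum>s\<in>I. (cmod (u s))\<^sup>2 * B)"
    unfolding W_def by (intro sum_mono mult_left_mono) auto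
  also have "\<dots> = B" by (simp add: norm1 flip: sum_distrib_right)
  finally have "W \<le> B" .
  have am_gm: "2 * Re (x * cnj y) \<le> (cmod x)\<^sup>2 + (cmod y)\<^sup>2" for x y
  proof -
    have "0 \<le> (Re x - Re y)\<^sup>2 + (Im x - Im y)\<^sup>2" by simp
    then show ?thesis unfolding cmod_power2 by (simp add: power2_eq_square algebra_simps)
  qed
  have "2 * (\<Sum>s\<in>I. \<Sum>t\<in>I. Re (u s * cnj (u t)) * (c s t)\<^sup>2)
      = (\<Sum>s\<in>I. \<Sum>t\<in>I. 2 * Re (u s * cnj (u t)) * (c s t)\<^sup>2)"
    by (simp only: sum_distrib_left mult_ac)
  also have "\<dots> \<le> (\<Sum>s\<in>I. \<Sum>t\<in>I. ((cmod (u s))\<^sup>2 + (cmod (u t))\<^sup>2) * (c s t)\<^sup>2)"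
    by (intro sum_mono mult_right_mono am_gm) auto
  also have "\<dots> = (\<Sum>s\<in>I. \<Sum>t\<in>I. (cmod (u s))\<^sup>2 * (c s t)\<^sup>2) + (\<Sum>s\<in>I. \<Sum>t\<in>I. (cmod (u t))\<^sup>2 * (c s t)\<^sup>2)"
    by (simp add: ring_distribs sum.distrib)
  also have "(\<Sum>s\<in>I. \<Sum>t\<in>I. (cmod (u t))\<^sup>2 * (c s t)\<^sup>2) = W"
    by (subst sum.swap) (simp add: W_def sum_distrib_left)
  also have "(\<Sum>s\<in>I. \<Sum>t\<in>I. (cmod (u s))\<^sup>2 * (c s t)\<^sup>2) = W"
    unfolding W_def sum_distrib_left by (intro sum.cong refl) (subst c2_sym, rule refl)
  finally show ?thesis using expansion \<open>W \<le> B\<close> unfolding W_def[symmetric] by linarith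
qed

text \<open>
  The form is purely imaginary, because the kernel is skew-symmetric. Its imaginary part is bounded
  above and below by the top eigenvalues of the two Hermitian kernels \<open>\<i> * c\<close> and \<open>- \<i> * c\<close>,
  and an eigenvalue of either one satisfies
  \<open>\<mu>\<^sup>2 \<le> 3 * (pi\<^sup>2 / (3 * \<delta>\<^sup>2)) = (pi / \<delta>)\<^sup>2\<close>.
\<close>

theorem hilbert_inequality_separated:
  fixes lam :: "'a \<Rightarrow> real" and v :: "'a \<Rightarrow> complex" and \<delta> :: real
  assumes fin: "finite I" and "\<delta> > 0"
    and sep: "\<And>m n. m \<in> I \<Longrightarrow> n \<in> I \<Longrightarrow> m \<noteq> n \<Longrightarrow> \<bar>lam m - lam n\<bar> \<ge> \<delta>"
  shows "cmod (\<Sum>r\<in>I. \<Sum>s\<in>I. complex_of_real (1 / (lam r - lam s)) * cnj (v r) * v s)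
         \<le> pi / \<delta> * (\<Sum>r\<in>I. (cmod (v r))\<^sup>2)"
proof (cases "I = {}")
  case False
  define c where "c r s = 1 / (lam r - lam s)" for r s
  have c_skew: "c s r = - c r s" for r s
    by (simp add: c_def minus_divide_right)
  have inj: "inj_on lam I"
    using sep \<open>\<delta> > 0\<close> by (intro inj_onI) (metis abs_0 diff_self not_less)
  define F where "F = (\<Sum>r\<in>I. \<Sum>s\<in>I. c r s * cnj (v r) * v s)"
  have "cnj F = - F"
  proof -
    have "cnj F = (\<Sum>r\<in>I. \<Sum>s\<in>I. c r s * v r * cnj (v s))" by (simp add: F_def)
    also have "\<dots> = (\<Sum>s\<in>I. \<Sum>r\<in>I. c r s * v r * cnj (v s))" by (rule sum.swap)
    also have "\<dots> = (\<Sum>s\<in>I. \<Sum>r\<in>I. - (c s r * cnj (v s) * v r))"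
      by (intro sum.cong refl) (subst c_skew, simp)
    finally show ?thesis by (simp add: F_def sum_negf)
  qed
  then have "Re F = 0" by (simp add: complex_eq_iff)
  have bound: "e * Im F \<le> pi / \<delta> * (\<Sum>r\<in>I. (cmod (v r))\<^sup>2)" if e: "e = 1 \<or> e = -1" for e :: real
  proof -
    define a where "a r s = - \<i> * complex_of_real (e * c r s)" for r s
    have herm: "a s r = cnj (a r s)" for r s by (simp add: a_def c_skew[of s r])
    obtain \<mu> :: real and u :: "'a \<Rightarrow> complex" where u: "(\<Sum>r\<in>I. (cmod (u r))\<^sup>2) = 1"
      and eig: "\<And>r. r \<in> I \<Longrightarrow> (\<Sum>s\<in>I. a r s * u s) = \<mu> * u r"
      and top: "\<And>v. Re (\<Sum>r\<in>I. \<Sum>s\<in>I. a r s * cnj (v r) * v s) \<le> \<mu> * (\<Sum>r\<in>I. (cmod (v r))\<^sup>2)"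
      by (rule hermitian_top_eigenvector[of I a, OF fin False herm]) (rule that)
    have eig_c: "(\<Sum>s\<in>I. c r s * u s) = \<i> * complex_of_real (e * \<mu>) * u r" if "r \<in> I" for r
    proof -
      have "(\<Sum>s\<in>I. a r s * u s) = - \<i> * e * (\<Sum>s\<in>I. c r s * u s)"
        by (simp add: a_def sum_distrib_left mult_ac)
      then have "- \<i> * e * (\<Sum>s\<in>I. c r s * u s) = \<mu> * u r" using eig[OF that] by simp
      then have "\<i> * e * (- \<i> * e * (\<Sum>s\<in>I. c r s * u s)) = \<i> * e * (\<mu> * u r)" by (simp only:)
      also have "\<dots> = \<i> * complex_of_real (e * \<mu>) * u r" by simp
      also have "\<i> * e * (- \<i> * e * z) = z" for z using e by auto
      finally show ?thesis .
    qed
    have "(e * \<mu>)\<^sup>2 \<le> 3 * (pi\<^sup>2 / (3 * \<delta>\<^sup>2))"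
    proof (rule skew_eigenvalue_bound[where lam = lam and u = u and I = I, OF fin inj u])
      show "(\<Sum>s\<in>I. complex_of_real (1 / (lam r - lam s)) * u s) = \<i> * complex_of_real (e * \<mu>) * u r"
        if "r \<in> I" for r
        using eig_c[OF that] unfolding c_def .
      show "(\<Sum>r\<in>I. (1 / (lam s - lam r))\<^sup>2) \<le> pi\<^sup>2 / (3 * \<delta>\<^sup>2)" if "s \<in> I" for s
        using fin \<open>\<delta> > 0\<close> that sep by (rule sum_inverse_squares_differences)
    qed
    moreover have "(e * \<mu>)\<^sup>2 = \<mu>\<^sup>2" using e by (auto simp: power2_eq_square)
    moreover have "3 * (pi\<^sup>2 / (3 * \<delta>\<^sup>2)) = (pi / \<delta>)\<^sup>2" by (simp add: power_divide)
    ultimately have "\<mu>\<^sup>2 \<le> (pi / \<delta>)\<^sup>2" by (simp only:)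
    moreover have "0 \<le> pi / \<delta>" using \<open>\<delta> > 0\<close> by simp
    ultimately have "\<mu> \<le> pi / \<delta>" by (rule power2_le_imp_le)
    have "(\<Sum>r\<in>I. \<Sum>s\<in>I. a r s * cnj (v r) * v s) = - \<i> * e * F"
      by (simp add: a_def F_def sum_distrib_left mult_ac)
    then have "e * Im F \<le> \<mu> * (\<Sum>r\<in>I. (cmod (v r))\<^sup>2)" using top[of v] by simp
    also have "\<dots> \<le> pi / \<delta> * (\<Sum>r\<in>I. (cmod (v r))\<^sup>2)"
      using \<open>\<mu> \<le> pi / \<delta>\<close> by (intro mult_right_mono sum_nonneg) auto
    finally show ?thesis .
  qed
  have "cmod F = \<bar>Im F\<bar>" using \<open>Re F = 0\<close> by (simp add: cmod_def)
  also have "\<dots> \<le> pi / \<delta> * (\<Sum>r\<in>I. (cmod (v r))\<^sup>2)"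
    using bound[of 1] bound[of "-1"] by (simp add: abs_le_iff)
  finally show ?thesis by (simp add: F_def c_def)
qed simp

section \<open>The mean value of an exponential sum\<close>

text \<open>
  For \<open>r \<noteq> s\<close> the function \<open>exp (\<i> * (lam s - lam r) * t)\<close> has the antiderivative
  \<open>\<i> / (lam r - lam s) * exp (\<i> * (lam s - lam r) * t)\<close>. The endpoint \<open>T\<close> can be absorbed into the
  coefficients, so that both boundary contributions are values of the same Hilbert form.
\<close>

lemma integral_norm_square_exponential_sum:
  fixes lam :: "'a \<Rightarrow> real" and d :: "'a \<Rightarrow> complex" and T :: real
  assumes fin: "finite I" and inj: "inj_on lam I" and "T \<ge> 0"
  shows "complex_of_real (integral {0..T} (\<lambda>t. (cmod (\<Sum>n\<in>I. d n * exp (\<i> * complex_of_real (t * lam n))))\<^sup>2))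
    = T * (\<Sum>n\<in>I. (cmod (d n))\<^sup>2)
      + \<i> * (\<Sum>r\<in>I. \<Sum>s\<in>I. complex_of_real (1 / (lam r - lam s)) * cnj (d r * exp (\<i> * complex_of_real (T * lam r))) * (d s * exp (\<i> * complex_of_real (T * lam s))))
      - \<i> * (\<Sum>r\<in>I. \<Sum>s\<in>I. complex_of_real (1 / (lam r - lam s)) * cnj (d r) * d s)"
proof -
  define e where "e t n = exp (\<i> * complex_of_real (t * lam n))" for t n
  define c where "c r s = complex_of_real (1 / (lam r - lam s))" for r s
  have e_mult: "cnj (e t r) * e t s = exp (\<i> * complex_of_real (lam s - lam r) * complex_of_real t)" for t r s
    unfolding e_def exp_cnj[symmetric] exp_add[symmetric] by (simp add: algebra_simps exp_cnj exp_add[symmetric])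
  have e0: "e 0 n = 1" for n by (simp add: e_def)
  define D where "D r s = cnj (d r) * d s * ((if r = s then complex_of_real T else 0) + \<i> * c r s * (cnj (e T r) * e T s - 1))" for r s
  have term_integral: "((\<lambda>t. cnj (d r) * d s * (cnj (e t r) * e t s)) has_integral D r s) {0..T}"
    if "r \<in> I" "s \<in> I" for r s
  proof (cases "r = s")
    case True
    have "cnj (e t s) * e t s = 1" for t by (simp add: e_mult)
    then show ?thesis
      using has_integral_const_real[of "cnj (d r) * d s" 0 T] \<open>T \<ge> 0\<close> True
      by (simp add: D_def c_def scaleR_conv_of_real mult_ac)
  next
    case False
    define z where "z = \<i> * complex_of_real (lam s - lam r)"
    have "lam s \<noteq> lam r" using False that inj by (auto dest: inj_onD)
    then have z0: "z \<noteq> 0" by (simp add: z_def)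
    have zc: "1 / z = \<i> * c r s"
      using \<open>lam s \<noteq> lam r\<close> by (simp add: z_def c_def field_simps)
    have "((\<lambda>t. exp (z * complex_of_real t)) has_integral
        (exp (z * complex_of_real T) / z - exp (z * complex_of_real 0) / z)) {0..T}"
    proof (rule fundamental_theorem_of_calculus[OF \<open>T \<ge> 0\<close>])
      fix x :: real
      have "((\<lambda>w. exp (z * w) / z) has_field_derivative exp (z * complex_of_real x)) (at (complex_of_real x))"
        using z0 by (auto intro!: derivative_eq_intros)
      then show "((\<lambda>t. exp (z * complex_of_real t) / z) has_vector_derivative exp (z * complex_of_real x)) (at x within {0..T})"
        by (intro has_vector_derivative_real_field[unfolded o_def] has_vector_derivative_at_within)
    qed
    then have "((\<lambda>t. cnj (e t r) * e t s) has_integral (1 / z * (cnj (e T r) * e T s - 1))) {0..T}"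
      by (simp add: e_mult z_def diff_divide_distrib)
    from has_integral_mult_right[OF this, of "cnj (d r) * d s"] show ?thesis
      using False by (simp add: D_def zc mult_ac)
  qed
  have square: "complex_of_real ((cmod (\<Sum>n\<in>I. d n * e t n))\<^sup>2)
      = (\<Sum>r\<in>I. \<Sum>s\<in>I. cnj (d r) * d s * (cnj (e t r) * e t s))" for t
  proof -
    have "complex_of_real ((cmod (\<Sum>n\<in>I. d n * e t n))\<^sup>2)
        = cnj (\<Sum>n\<in>I. d n * e t n) * (\<Sum>n\<in>I. d n * e t n)"
      unfolding complex_norm_square by (rule mult.commute)
    then show ?thesis unfolding cnj_sum sum_product by (simp add: mult_ac)
  qed
  have "((\<lambda>t. complex_of_real ((cmod (\<Sum>n\<in>I. d n * e t n))\<^sup>2)) has_integral (\<Sum>r\<in>I. \<Sum>s\<in>I. D r s)) {0..T}"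
    unfolding square by (intro has_integral_sum fin term_integral)
  moreover have "(\<lambda>t. (cmod (\<Sum>n\<in>I. d n * e t n))\<^sup>2) integrable_on {0..T}"
    unfolding e_def by (intro integrable_continuous_real continuous_intros)
  then have "((\<lambda>t. complex_of_real ((cmod (\<Sum>n\<in>I. d n * e t n))\<^sup>2)) has_integral
      complex_of_real (integral {0..T} (\<lambda>t. (cmod (\<Sum>n\<in>I. d n * e t n))\<^sup>2))) {0..T}"
    by (intro has_integral_of_real) (simp add: integrable_integral)
  ultimately have "complex_of_real (integral {0..T} (\<lambda>t. (cmod (\<Sum>n\<in>I. d n * e t n))\<^sup>2)) = (\<Sum>r\<in>I. \<Sum>s\<in>I. D r s)"
    by (rule has_integral_unique[symmetric])
  also have "\<dots> = (\<Sum>r\<in>I. \<Sum>s\<in>I. (if r = s then T * (cnj (d r) * d s) else 0)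
      + \<i> * (c r s * cnj (d r * e T r) * (d s * e T s)) - \<i> * (c r s * cnj (d r) * d s))"
    by (intro sum.cong refl) (simp add: D_def algebra_simps)
  also have "\<dots> = T * (\<Sum>n\<in>I. (cmod (d n))\<^sup>2)
      + \<i> * (\<Sum>r\<in>I. \<Sum>s\<in>I. c r s * cnj (d r * e T r) * (d s * e T s))
      - \<i> * (\<Sum>r\<in>I. \<Sum>s\<in>I. c r s * cnj (d r) * d s)"
    unfolding sum.distrib sum_subtractf
    using fin by (simp add: sum_distrib_left complex_norm_square mult_ac del: of_real_power)
  finally show ?thesis unfolding e_def c_def .
qed

text \<open>
  Multiplying the coefficients by the unimodular factors \<open>exp (\<i> * T * lam n)\<close> preserves their
  norm, so Hilbert's inequality bounds both boundary contributions by the same quantity.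
\<close>

theorem mean_value_separated_frequencies:
  fixes lam :: "'a \<Rightarrow> real" and d :: "'a \<Rightarrow> complex" and \<delta> T :: real
  assumes fin: "finite I" and "\<delta> > 0" and "T \<ge> 0"
    and sep: "\<And>m n. m \<in> I \<Longrightarrow> n \<in> I \<Longrightarrow> m \<noteq> n \<Longrightarrow> \<bar>lam m - lam n\<bar> \<ge> \<delta>"
  shows "\<bar>integral {0..T} (\<lambda>t. (cmod (\<Sum>n\<in>I. d n * exp (\<i> * complex_of_real (t * lam n))))\<^sup>2)
            - T * (\<Sum>n\<in>I. (cmod (d n))\<^sup>2)\<bar>
          \<le> 2 * pi / \<delta> * (\<Sum>n\<in>I. (cmod (d n))\<^sup>2)" (is "\<bar>?J - T * ?S\<bar> \<le> _")
proof -
  have inj: "inj_on lam I"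
    using sep \<open>\<delta> > 0\<close> by (intro inj_onI) (metis abs_0 diff_self not_less)
  define H where "H v = (\<Sum>r\<in>I. \<Sum>s\<in>I. complex_of_real (1 / (lam r - lam s)) * cnj (v r) * v s)" for v
  define w where "w n = d n * exp (\<i> * complex_of_real (T * lam n))" for n
  have cw: "cmod (w n) = cmod (d n)" for n
    by (simp add: w_def norm_mult)
  have "complex_of_real (?J - T * ?S) = \<i> * H w - \<i> * H d"
    unfolding of_real_diff integral_norm_square_exponential_sum[OF fin inj \<open>T \<ge> 0\<close>]
    by (simp add: H_def w_def)
  then have "\<bar>?J - T * ?S\<bar> = cmod (\<i> * H w - \<i> * H d)"
    using norm_of_real[of "?J - T * ?S", where 'a = complex] by (simp only:)
  also have "\<dots> \<le> cmod (H w) + cmod (H d)"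
    using norm_triangle_ineq4[of "\<i> * H w" "\<i> * H d"] by (simp add: norm_mult)
  also have "\<dots> \<le> pi / \<delta> * ?S + pi / \<delta> * ?S"
    using hilbert_inequality_separated[OF fin \<open>\<delta> > 0\<close> sep, where v = w]
      hilbert_inequality_separated[OF fin \<open>\<delta> > 0\<close> sep, where v = d]
    unfolding H_def cw by (intro add_mono)
  finally show ?thesis by (simp add: field_simps)
qed

theorem proposition6:
  fixes N :: nat and lam :: "nat \<Rightarrow> real" and \<delta> T :: real and d :: "nat \<Rightarrow> complex"
  assumes "N \<ge> 1"
    and "inj_on lam {1..N}"
    and "\<delta> > 0"
    and "\<And>m n. m \<in> {1..N} \<Longrightarrow> n \<in> {1..N} \<Longrightarrow> m \<noteq> n \<Longrightarrow> \<bar>lam m - lam n\<bar> \<ge> \<delta>"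
    and "T > 0"
  shows "\<bar>integral {0..T} (\<lambda>t. (cmod (\<Sum>n=1..N. d n * exp (\<i> * complex_of_real (t * lam n))))\<^sup>2)
            - T * (\<Sum>n=1..N. (cmod (d n))\<^sup>2)\<bar>
          \<le> 4 * pi / \<delta> * (\<Sum>n=1..N. (cmod (d n))\<^sup>2)"
proof -
  have "2 * pi / \<delta> * (\<Sum>n=1..N. (cmod (d n))\<^sup>2) \<le> 4 * pi / \<delta> * (\<Sum>n=1..N. (cmod (d n))\<^sup>2)"
    using \<open>\<delta> > 0\<close> by (intro mult_right_mono divide_right_mono sum_nonneg) auto
  moreover have "\<bar>integral {0..T} (\<lambda>t. (cmod (\<Sum>n=1..N. d n * exp (\<i> * complex_of_real (t * lam n))))\<^sup>2)
      - T * (\<Sum>n=1..N. (cmod (d n))\<^sup>2)\<bar> \<le> 2 * pi / \<delta> * (\<Sum>n=1..N. (cmod (d n))\<^sup>2)"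
    using \<open>\<delta> > 0\<close> \<open>T > 0\<close> assms(4) by (intro mean_value_separated_frequencies) auto
  ultimately show ?thesis by (rule order_trans[rotated])
qed

end
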